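(* Let $n\ge 3$, let $\{e_1,\dots,e_{n^2-1}\}$ be a basis of $\mathfrak{sl}_n(\mathbb{C})$ and let $z\in\mathfrak{gl}_n(\mathbb{C})$ be a nonzero scalar matrix, so that $\{e_1,\dots,e_{n^2-1},z\}$ is a basis of $\mathfrak{gl}_n(\mathbb{C})$. Let $D\in\mathrm{HLie}_m(\mathfrak{gl}_n(\mathbb{C}))$ be arbitrary. Then, with respect to the basis $\{e_1,\dots,e_{n^2-1},z\}$, $D$ is equal to either $\mathrm{diag}\{1,\dots,1,a\}$ or $\mathrm{diag}\{0,\dots,0,a\}$ for some $a\in\mathbb{C}$.
   Context: A linear map $D:\mathfrak{g}\to\mathfrak{g}$ on a finite-dimensional complex Lie algebra $\mathfrak{g}$ is a Hom-Lie algebra structure on $\mathfrak{g}$ if $[D(x),[y,z]]+[D(y),[z,x]]+[D(z),[x,y]]=0$ for all $x,y,z\in\mathfrak{g}$; it is multiplicative if moreover $D([x,y])=[D(x),D(y)]$ for all $x,y\in\mathfrak{g}$. $\mathrm{HLie}_m(\mathfrak{g})$ is the set of all multiplicative Hom-Lie algebra structures on $\mathfrak{g}$. *)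

theory Defs
  imports "HOL-Analysis.Analysis"
begin

subsection \<open>Indexed bases and coordinate matrices\<close>

context vector_space
begin

definition indexed_basis :: "'i set \<Rightarrow> ('i \<Rightarrow> 'b) \<Rightarrow> 'b set \<Rightarrow> bool" where
  "indexed_basis I b V \<longleftrightarrow> inj_on b I \<and> independent (b ` I) \<and> span (b ` I) = V"

text \<open>Column \<open>j\<close> holds the coordinates of \<open>f (b j)\<close>. Entries are meaningful only for
  indices in \<open>I\<close>, and only if \<open>b\<close> is an indexed basis of the whole space:
  \<^const>\<open>representation\<close> is zero outside the span of an independent set.\<close>

definition matrix_wrt :: "'i set \<Rightarrow> ('i \<Rightarrow> 'b) \<Rightarrow> ('b \<Rightarrow> 'b) \<Rightarrow> 'i \<Rightarrow> 'i \<Rightarrow> 'a" where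
  "matrix_wrt I b f i j = representation (b ` I) (f (b j)) (b i)"

end

definition diag :: "('i \<Rightarrow> 'a::zero) \<Rightarrow> 'i \<Rightarrow> 'i \<Rightarrow> 'a" where
  "diag d i j = (if i = j then d i else 0)"


subsection \<open>Hom-Lie algebra structures\<close>

locale fd_complex_lie_algebra =
  vector_space scale for scale :: "complex \<Rightarrow> 'g::ab_group_add \<Rightarrow> 'g" +
  fixes bracket :: "'g \<Rightarrow> 'g \<Rightarrow> 'g"
  assumes finite_dimensional: "\<exists>B. finite B \<and> span B = UNIV"
    and linear_bracket_left: "Vector_Spaces.linear scale scale (\<lambda>x. bracket x y)"
    and linear_bracket_right: "Vector_Spaces.linear scale scale (bracket x)"
    and bracket_self: "bracket x x = 0"
    and jacobi: "bracket x (bracket y z) + bracket y (bracket z x) + bracket z (bracket x y) = 0"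
begin

definition hom_lie_structure :: "('g \<Rightarrow> 'g) \<Rightarrow> bool" where
  "hom_lie_structure D \<longleftrightarrow> Vector_Spaces.linear scale scale D \<and>
    (\<forall>x y z. bracket (D x) (bracket y z) + bracket (D y) (bracket z x)
      + bracket (D z) (bracket x y) = 0)"

definition multiplicative :: "('g \<Rightarrow> 'g) \<Rightarrow> bool" where
  "multiplicative D \<longleftrightarrow> (\<forall>x y. D (bracket x y) = bracket (D x) (D y))"

definition HLie\<^sub>m :: "('g \<Rightarrow> 'g) set" where
  "HLie\<^sub>m = {D. hom_lie_structure D \<and> multiplicative D}"

end


subsection \<open>The Lie algebras of all and of traceless complex matrices\<close>

text \<open>The library's \<^const>\<open>vector_scalar_mult\<close>, at the type of square complex matrices, would
  take its scalars from the rows, so complex scaling of a matrix is defined entrywise.\<close>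

definition matrix_scale :: "complex \<Rightarrow> complex^'n^'n \<Rightarrow> complex^'n^'n" where
  "matrix_scale c A = (\<chi> i j. c * A $ i $ j)"

definition commutator :: "complex^'n^'n \<Rightarrow> complex^'n^'n \<Rightarrow> complex^'n^'n" where
  "commutator A B = A ** B - B ** A"

definition sl :: "(complex^'n^'n) set" where
  "sl = {A. trace A = 0}"

lemma vector_space_matrix_scale: "vector_space (matrix_scale :: _ \<Rightarrow> complex^'n^'n \<Rightarrow> _)"
  by unfold_locales (simp_all add: matrix_scale_def vec_eq_iff algebra_simps)

lemma matrix_mult_scale:
  "matrix_scale c A ** B = matrix_scale c (A ** B)"
  "A ** matrix_scale c B = matrix_scale c (A ** B)"
  by (simp_all add: matrix_scale_def matrix_matrix_mult_def vec_eq_iff sum_distrib_left mult_ac)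

lemma matrix_scale_diff: "matrix_scale c (A - B) = matrix_scale c A - matrix_scale c B"
  by (simp add: matrix_scale_def vec_eq_iff algebra_simps)

lemma matrix_mult_distribs:
  fixes A B C :: "complex^'n^'n"
  shows "A ** (B + C) = A ** B + A ** C" "(B + C) ** A = B ** A + C ** A"
    "A ** (B - C) = A ** B - A ** C" "(B - C) ** A = B ** A - C ** A"
  by (simp_all add: matrix_matrix_mult_def vec_eq_iff algebra_simps sum.distrib sum_subtractf)

lemma matrix_finite_dimensional:
  "\<exists>B::(complex^'n^'n) set. finite B \<and> module.span matrix_scale B = UNIV"
proof -
  interpret vector_space "matrix_scale :: _ \<Rightarrow> complex^'n^'n \<Rightarrow> _"
    by (rule vector_space_matrix_scale)
  define E :: "'n \<times> 'n \<Rightarrow> complex^'n^'n"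
    where "E p = (\<chi> i j. if p = (i, j) then 1 else 0)" for p
  have "A \<in> span (range E)" for A
  proof -
    have "A = (\<Sum>p\<in>UNIV. matrix_scale (A $ fst p $ snd p) (E p))"
      by (simp add: vec_eq_iff matrix_scale_def E_def if_distrib[where f = "\<lambda>x. _ * x"]
          cong: if_cong)
    moreover have "\<dots> \<in> span (range E)"
      by (intro span_sum span_scale span_base) simp
    ultimately show ?thesis by simp
  qed
  then show ?thesis by (intro exI[of _ "range E"]) auto
qed

global_interpretation gl: fd_complex_lie_algebra
  "matrix_scale :: complex \<Rightarrow> complex^'n^'n \<Rightarrow> complex^'n^'n" commutator
proof -
  interpret vector_space "matrix_scale :: _ \<Rightarrow> complex^'n^'n \<Rightarrow> _"
    by (rule vector_space_matrix_scale)
  have lin: "Vector_Spaces.linear matrix_scale matrix_scale f"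
    if "\<And>x y. f (x + y) = f x + f y" "\<And>c x. f (matrix_scale c x) = matrix_scale c (f x)"
    for f :: "complex^'n^'n \<Rightarrow> complex^'n^'n"
    using that vector_space_matrix_scale by (simp add: Vector_Spaces.linear_iff)
  show "fd_complex_lie_algebra (matrix_scale :: _ \<Rightarrow> complex^'n^'n \<Rightarrow> _) commutator"
  proof (intro fd_complex_lie_algebra.intro vector_space_matrix_scale
      fd_complex_lie_algebra_axioms.intro)
    show "\<exists>B::(complex^'n^'n) set. finite B \<and> span B = UNIV"
      by (rule matrix_finite_dimensional)
  next
    fix x y z :: "complex^'n^'n"
    show "Vector_Spaces.linear matrix_scale matrix_scale (\<lambda>x. commutator x y)"
      by (rule lin) (simp_all add: commutator_def matrix_mult_scale matrix_scale_diff
          matrix_mult_distribs)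
    show "Vector_Spaces.linear matrix_scale matrix_scale (commutator x)"
      by (rule lin) (simp_all add: commutator_def matrix_mult_scale matrix_scale_diff
          matrix_mult_distribs)
    show "commutator x x = 0"
      by (simp add: commutator_def)
    show "commutator x (commutator y z) + commutator y (commutator z x)
        + commutator z (commutator x y) = 0"
      by (simp add: commutator_def matrix_mult_distribs matrix_mul_assoc)
  qed
qed

end

theory Submission
  imports Defs
begin

text \<open>
  The Hom-Jacobi identity forces \<open>D\<close> to be a multiple of the identity plus a scalar-valued map,
  and multiplicativity restricts the multiple and that map. Write \<open>[A, B]\<close> for the commutator.

  If \<open>y\<close> and \<open>w\<close> commute with \<open>x\<close>, then two of the three terms of the Hom-Jacobi identity
  vanish and \<open>D x\<close> commutes with \<open>[y, w]\<close>. For a matrix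
  unit \<open>x = E\<^sub>i\<^sub>j\<close> and \<open>n \<ge> 3\<close> there are enough such commutators to force
  \<open>D x = \<alpha>\<^sub>i\<^sub>j x + scalar\<close> (\<open>hom_lie_matrix_unit\<close>). If only \<open>x\<close> and \<open>w\<close> commute, two terms survive,
  and comparison with the Jacobi identity shows that the factors \<open>\<alpha>\<close> at \<open>x\<close> and \<open>w\<close> agree as soon
  as \<open>[x, [y, w]] \<noteq> 0\<close> for some \<open>y\<close> (\<open>hom_lie_coefficients_eq\<close>). This connects
  all matrix units, so by linearity \<open>D A = c A + \<tau>(A) I\<close> with one constant \<open>c\<close>
  (\<open>hom_lie_structure_shape\<close>).

  Multiplicativity now reads \<open>c [A, B] + \<tau>([A, B]) I = c\<^sup>2 [A, B]\<close>. Commutators are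
  traceless, so \<open>\<tau>\<close> vanishes on them and \<open>c\<^sup>2 = c\<close>. A linear functional that kills all commutators
  is a multiple of the trace, so \<open>D A = c A + t tr(A) I\<close> with \<open>c \<in> {0, 1}\<close>
  (\<open>multiplicative_hom_lie_shape\<close>). This map is \<open>c\<close> on \<open>sl\<close> and \<open>c + t n\<close> on scalar
  matrices, which is the assertion about its matrix.
\<close>

section \<open>Matrix units\<close>

definition matrix_unit :: "'n \<Rightarrow> 'n \<Rightarrow> complex^'n^'n" where
  "matrix_unit i j = (\<chi> a b. if a = i \<and> b = j then 1 else 0)"

lemma matrix_unit_nth: "matrix_unit i j $ a $ b = (if a = i \<and> b = j then 1 else 0)"
  by (simp add: matrix_unit_def)

lemma mult_matrix_unit_nth: "(M ** matrix_unit i j) $ a $ b = (if b = j then M $ a $ i else 0)"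
  by (simp add: matrix_unit_def matrix_matrix_mult_def if_distrib[where f = "\<lambda>x. _ * x"]
      cong: if_cong)

lemma matrix_unit_mult_nth: "(matrix_unit i j ** M) $ a $ b = (if a = i then M $ j $ b else 0)"
  by (simp add: matrix_unit_def matrix_matrix_mult_def if_distrib[where f = "\<lambda>x. x * _"]
      cong: if_cong)

lemma matrix_unit_mult_matrix_unit:
  "matrix_unit i j ** matrix_unit k l = (if j = k then matrix_unit i l else 0)"
  by (auto simp: vec_eq_iff mult_matrix_unit_nth matrix_unit_nth)

lemma matrix_eq_sum_matrix_units:
  "A = (\<Sum>i\<in>UNIV. \<Sum>j\<in>UNIV. matrix_scale (A $ i $ j) (matrix_unit i j))"
proof -
  have "(\<Sum>i\<in>UNIV. \<Sum>j\<in>UNIV. A $ i $ j * (if a = i \<and> b = j then 1 else 0)) = A $ a $ b"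
    for a b
  proof -
    have "(\<Sum>i\<in>UNIV. \<Sum>j\<in>UNIV. A $ i $ j * (if a = i \<and> b = j then 1 else 0))
        = (\<Sum>i\<in>UNIV. if a = i then A $ i $ b else 0)"
      by (intro sum.cong) (auto simp: if_distrib[where f = "\<lambda>x. _ * x"] cong: if_cong)
    then show ?thesis by simp
  qed
  then show ?thesis
    by (simp add: vec_eq_iff matrix_scale_def matrix_unit_nth)
qed

text \<open>The product \<open>M E\<^sub>a\<^sub>b\<close> has column \<open>a\<close> of \<open>M\<close> as its column \<open>b\<close>, and \<open>E\<^sub>a\<^sub>b M\<close> has row \<open>b\<close> of
  \<open>M\<close> as its row \<open>a\<close>; all other entries are zero. If they agree, both are zero outside the position \<open>(a, b)\<close>,
  where they contain diagonal entries of \<open>M\<close>.\<close>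

lemma commute_matrix_unitD:
  assumes "commutator M (matrix_unit a b) = 0"
  shows "p \<noteq> a \<Longrightarrow> M $ p $ a = 0" and "q \<noteq> b \<Longrightarrow> M $ b $ q = 0" and "M $ a $ a = M $ b $ b"
proof -
  have eq: "(if q = b then M $ p $ a else 0) = (if p = a then M $ b $ q else 0)" for p q
  proof -
    have "M ** matrix_unit a b = matrix_unit a b ** M"
      using assms by (simp add: commutator_def)
    then have "(M ** matrix_unit a b) $ p $ q = (matrix_unit a b ** M) $ p $ q" by simp
    then show ?thesis by (simp only: mult_matrix_unit_nth matrix_unit_mult_nth)
  qed
  show "p \<noteq> a \<Longrightarrow> M $ p $ a = 0" using eq[of b p] by simp
  show "q \<noteq> b \<Longrightarrow> M $ b $ q = 0" using eq[of q a] by simp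
  show "M $ a $ a = M $ b $ b" using eq[of b a] by simp
qed

lemma mat_0: "mat 0 = (0 :: complex^'n^'n)"
  by (simp add: mat_def vec_eq_iff)

lemma commutator_scale_add_mat:
  "commutator (matrix_scale c A + mat b) B = matrix_scale c (commutator A B)"
proof -
  have "mat b ** B = matrix_scale b B"
    by (simp add: mat_def matrix_scale_def matrix_matrix_mult_def vec_eq_iff
        if_distrib[where f = "\<lambda>x. x * _"] cong: if_cong)
  moreover have "B ** mat b = matrix_scale b B"
    by (simp add: mat_def matrix_scale_def matrix_matrix_mult_def vec_eq_iff
        if_distrib[where f = "\<lambda>x. _ * x"] cong: if_cong)
  ultimately show ?thesis
    by (simp add: commutator_def matrix_mult_distribs matrix_mult_scale matrix_scale_diff)
qed

lemma trace_commutator: "trace (commutator A B) = 0"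
  by (simp add: commutator_def trace_sub trace_mul_sym[of A B])

lemma trace_matrix_scale: "trace (matrix_scale c A) = c * trace A"
  by (simp add: trace_def matrix_scale_def sum_distrib_left)

lemma trace_mat: "trace (mat c :: complex^'n^'n) = of_nat CARD('n) * c"
  by (simp add: trace_def mat_def)

lemma exists_index_avoiding_two:
  fixes i j :: "'n::finite"
  assumes "CARD('n) \<ge> 3"
  obtains k where "k \<noteq> i" "k \<noteq> j"
proof -
  have "card {i, j} \<le> 2" by (simp add: card_insert_if)
  then have "{i, j} \<noteq> UNIV" using assms by auto
  then show ?thesis using that by blast
qed

section \<open>Hom-Lie structures on the Lie algebra of all matrices\<close>

lemma hom_lie_structure_linear:
  assumes "gl.hom_lie_structure D"
  shows "D (A + B) = D A + D B" and "D (matrix_scale c A) = matrix_scale c (D A)"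
    and "D 0 = 0" and "D (\<Sum>s\<in>S. f s) = (\<Sum>s\<in>S. D (f s))"
proof -
  have lin: "Vector_Spaces.linear matrix_scale matrix_scale D"
    using assms by (simp add: gl.hom_lie_structure_def)
  interpret Vector_Spaces.linear matrix_scale matrix_scale D by (fact lin)
  show "D (A + B) = D A + D B" "D (matrix_scale c A) = matrix_scale c (D A)" "D 0 = 0"
    "D (\<Sum>s\<in>S. f s) = (\<Sum>s\<in>S. D (f s))"
    by (rule add scale zero sum)+
qed

lemma hom_jacobi:
  assumes "gl.hom_lie_structure D"
  shows "commutator (D x) (commutator y w) + commutator (D y) (commutator w x)
    + commutator (D w) (commutator x y) = 0"
  using assms by (simp add: gl.hom_lie_structure_def)

text \<open>The image of \<open>x\<close> commutes with the derived algebra of the centralizer of \<open>x\<close>.\<close>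

lemma hom_lie_commutes_derived_centralizer:
  assumes "gl.hom_lie_structure D" and "commutator w x = 0" and "commutator x y = 0"
  shows "commutator (D x) (commutator y w) = 0"
  using hom_jacobi[OF assms(1), of x y w] assms(2,3) by (simp add: commutator_def)

text \<open>For \<open>k\<close> different from \<open>i\<close> and \<open>j\<close>, the units \<open>E\<^sub>a\<^sub>k\<close> and \<open>E\<^sub>k\<^sub>b\<close> centralize \<open>E\<^sub>i\<^sub>j\<close>, and
  \<open>[E\<^sub>a\<^sub>k, E\<^sub>k\<^sub>b] = E\<^sub>a\<^sub>b\<close>. So the image of \<open>E\<^sub>i\<^sub>j\<close> commutes with all the units \<open>E\<^sub>a\<^sub>b\<close> below, and
  these leave only the entry \<open>(i, j)\<close> and a constant diagonal.\<close>

lemma hom_lie_matrix_unit: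
  fixes i j :: "'n::finite"
  assumes D: "gl.hom_lie_structure D" and n: "CARD('n) \<ge> 3"
  obtains \<alpha> \<beta> where "D (matrix_unit i j) = matrix_scale \<alpha> (matrix_unit i j) + mat \<beta>"
proof -
  define M where "M = D (matrix_unit i j)"
  obtain k where k: "k \<noteq> i" "k \<noteq> j" using exists_index_avoiding_two[OF n] by metis
  have comm: "commutator M (matrix_unit a b) = 0" if "a \<noteq> b" "a \<noteq> j" "b \<noteq> i" for a b
  proof -
    have "commutator (matrix_unit a k) (matrix_unit k b) = matrix_unit a b"
      using that by (simp add: commutator_def matrix_unit_mult_matrix_unit)
    then show ?thesis
      using hom_lie_commutes_derived_centralizer[OF D, of "matrix_unit k b" "matrix_unit i j"
          "matrix_unit a k"] that k
      by (simp add: M_def commutator_def matrix_unit_mult_matrix_unit)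
  qed
  have col: "M $ p $ q = 0" if "p \<noteq> q" "q \<noteq> j" for p q
  proof -
    obtain b where "b \<noteq> i" "b \<noteq> q" using exists_index_avoiding_two[OF n] by metis
    then show ?thesis using commute_matrix_unitD(1)[OF comm] that by metis
  qed
  have row: "M $ p $ q = 0" if "p \<noteq> q" "p \<noteq> i" for p q
  proof -
    obtain a where "a \<noteq> j" "a \<noteq> p" using exists_index_avoiding_two[OF n] by metis
    then show ?thesis using commute_matrix_unitD(2)[OF comm] that by metis
  qed
  have diag_eq: "M $ a $ a = M $ b $ b" if "a \<noteq> j" "b \<noteq> i" for a b
    using commute_matrix_unitD(3)[OF comm] that by (cases "a = b") auto
  have diag_k: "M $ p $ p = M $ k $ k" if "i \<noteq> j \<or> p \<noteq> i" for p
    using that diag_eq k by (cases "p = i") metis+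
  \<comment> \<open>On the diagonal, the scalar part has to be removed from the entry \<open>(i, j)\<close>.\<close>
  define \<alpha> where "\<alpha> = M $ i $ j - (if i = j then M $ k $ k else 0)"
  have "M = matrix_scale \<alpha> (matrix_unit i j) + mat (M $ k $ k)"
    unfolding vec_eq_iff
  proof (intro allI)
    fix p q
    show "M $ p $ q = (matrix_scale \<alpha> (matrix_unit i j) + mat (M $ k $ k)) $ p $ q"
      using col[of p q] row[of p q] diag_k[of p]
      by (auto simp: matrix_scale_def matrix_unit_nth mat_def \<alpha>_def)
  qed
  then show ?thesis using that by (simp add: M_def)
qed

text \<open>With the test element \<open>E\<^sub>j\<^sub>k\<close> between \<open>E\<^sub>i\<^sub>j\<close> and \<open>E\<^sub>k\<^sub>l\<close>, the middle term of the Hom-Jacobi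
  identity vanishes and the two others are opposite multiples of one matrix, whose entry
  \<open>(i, l)\<close> is \<open>1\<close> or \<open>2\<close>.\<close>

lemma hom_lie_coefficients_eq:
  assumes D: "gl.hom_lie_structure D"
    and ij: "D (matrix_unit i j) = matrix_scale \<alpha> (matrix_unit i j) + mat \<beta>"
    and kl: "D (matrix_unit k l) = matrix_scale \<gamma> (matrix_unit k l) + mat \<delta>"
    and "j \<noteq> k" and "i \<noteq> l"
  shows "\<alpha> = \<gamma>"
proof -
  let ?x = "matrix_unit i j" and ?y = "matrix_unit j k" and ?w = "matrix_unit k l"
  define X where "X = commutator ?x (commutator ?y ?w)"
  have wx: "commutator ?w ?x = 0"
    using assms(4,5) by (simp add: commutator_def matrix_unit_mult_matrix_unit)
  then have "X + commutator ?w (commutator ?x ?y) = 0"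
    using gl.jacobi[of ?x ?y ?w] by (simp add: X_def) (simp add: commutator_def)
  then have "commutator ?w (commutator ?x ?y) = - X"
    by (simp add: eq_neg_iff_add_eq_0 add.commute)
  moreover have "commutator (D ?x) (commutator ?y ?w) + commutator (D ?w) (commutator ?x ?y) = 0"
    using hom_jacobi[OF D, of ?x ?y ?w] wx by (simp add: commutator_def)
  ultimately have "matrix_scale \<alpha> X + matrix_scale \<gamma> (- X) = 0"
    by (simp add: ij kl commutator_scale_add_mat X_def)
  then have "(matrix_scale \<alpha> X + matrix_scale \<gamma> (- X)) $ i $ l = 0" by (simp only: zero_index)
  then have "(\<alpha> - \<gamma>) * X $ i $ l = 0"
    by (simp add: matrix_scale_def algebra_simps)
  moreover have "X $ i $ l \<noteq> 0"
    using assms(4,5)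
    by (auto simp: X_def commutator_def matrix_mult_distribs matrix_unit_mult_matrix_unit
        matrix_unit_nth)
  ultimately show ?thesis by simp
qed

lemma hom_lie_structure_shape:
  fixes D :: "complex^'n^'n \<Rightarrow> complex^'n^'n"
  assumes D: "gl.hom_lie_structure D" and n: "CARD('n) \<ge> 3"
  obtains c \<tau> where "\<And>A. D A = matrix_scale c A + mat (\<Sum>i\<in>UNIV. \<Sum>j\<in>UNIV. A $ i $ j * \<tau> i j)"
proof -
  obtain \<alpha> \<tau> where unit: "D (matrix_unit i j) = matrix_scale (\<alpha> i j) (matrix_unit i j) + mat (\<tau> i j)"
    for i j
  proof -
    have "\<exists>\<alpha> \<tau>. D (matrix_unit i j) = matrix_scale \<alpha> (matrix_unit i j) + mat \<tau>" for i j
      using hom_lie_matrix_unit[OF D n, of i j] by blast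
    then show ?thesis using that by metis
  qed
  have link: "\<alpha> i j = \<alpha> k l" if "j \<noteq> k" "i \<noteq> l" for i j k l
    using hom_lie_coefficients_eq[OF D unit unit that] .
  fix p :: 'n
  define c where "c = \<alpha> p p"
  have const: "\<alpha> i j = c" for i j
  proof -
    \<comment> \<open>A diagonal position away from \<open>i\<close> and \<open>j\<close> is linked to \<open>(i, j)\<close>, and any two diagonal
      positions are linked.\<close>
    obtain k where "k \<noteq> i" "k \<noteq> j" using exists_index_avoiding_two[OF n] by metis
    then have "\<alpha> i j = \<alpha> k k" using link[of j k i k] by simp
    also have "\<dots> = c" using link[of k p k p] by (cases "k = p") (auto simp: c_def)
    finally show ?thesis .
  qed
  have "D A = matrix_scale c A + mat (\<Sum>i\<in>UNIV. \<Sum>j\<in>UNIV. A $ i $ j * \<tau> i j)" for A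
  proof -
    have "D A = D (\<Sum>i\<in>UNIV. \<Sum>j\<in>UNIV. matrix_scale (A $ i $ j) (matrix_unit i j))"
      by (rule arg_cong[OF matrix_eq_sum_matrix_units])
    also have "\<dots> = (\<Sum>i\<in>UNIV. \<Sum>j\<in>UNIV. matrix_scale (A $ i $ j)
        (matrix_scale c (matrix_unit i j) + mat (\<tau> i j)))"
      by (simp add: hom_lie_structure_linear[OF D] unit const)
    also have "\<dots> = matrix_scale c
          (\<Sum>i\<in>UNIV. \<Sum>j\<in>UNIV. matrix_scale (A $ i $ j) (matrix_unit i j))
        + mat (\<Sum>i\<in>UNIV. \<Sum>j\<in>UNIV. A $ i $ j * \<tau> i j)"
      by (simp add: vec_eq_iff matrix_scale_def mat_def algebra_simps sum.distrib
          sum_distrib_left)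
    finally show ?thesis by (simp only: matrix_eq_sum_matrix_units[of A, symmetric])
  qed
  then show ?thesis by (rule that)
qed

section \<open>Multiplicative structures\<close>

lemma multiplicative_hom_lie_shape:
  fixes D :: "complex^'n^'n \<Rightarrow> complex^'n^'n"
  assumes "D \<in> gl.HLie\<^sub>m" and n: "CARD('n) \<ge> 3"
  obtains c t where "c = 0 \<or> c = 1" and "\<And>A. D A = matrix_scale c A + mat (t * trace A)"
proof -
  have D: "gl.hom_lie_structure D" and mult: "D (commutator A B) = commutator (D A) (D B)" for A B
    using assms(1) by (auto simp: gl.HLie\<^sub>m_def gl.multiplicative_def)
  obtain c \<tau> where
    shape: "D A = matrix_scale c A + mat (\<Sum>i\<in>UNIV. \<Sum>j\<in>UNIV. A $ i $ j * \<tau> i j)" for A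
    using hom_lie_structure_shape[OF D n] by blast
  define T where "T A = (\<Sum>i\<in>UNIV. \<Sum>j\<in>UNIV. A $ i $ j * \<tau> i j)" for A
  have T_unit: "T (matrix_unit i j) = \<tau> i j" for i j
  proof -
    have "T (matrix_unit i j) = (\<Sum>a\<in>UNIV. if a = i then \<tau> a j else 0)"
      unfolding T_def by (intro sum.cong) (auto simp: matrix_unit_nth
          if_distrib[where f = "\<lambda>x. x * _"] cong: if_cong)
    then show ?thesis by simp
  qed
  have DT: "D A = matrix_scale c A + mat (T A)" for A
    by (simp add: shape T_def)
  have comm_D: "commutator (D A) (D B) = matrix_scale (c * c) (commutator A B)" for A B
  proof -
    have skew: "commutator P Q = - commutator Q P" for P Q :: "complex^'n^'n"
      by (simp add: commutator_def)
    have "commutator (D A) (D B) = matrix_scale c (commutator A (D B))"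
      by (simp add: DT commutator_scale_add_mat)
    also have "commutator A (D B) = - matrix_scale c (commutator B A)"
      by (simp add: skew[of A] DT commutator_scale_add_mat)
    also have "\<dots> = matrix_scale c (commutator A B)"
      by (simp add: skew[of B] vec_eq_iff matrix_scale_def)
    finally show ?thesis by (simp add: vec_eq_iff matrix_scale_def)
  qed
  have key: "matrix_scale c (commutator A B) + mat (T (commutator A B))
      = matrix_scale (c * c) (commutator A B)" for A B
    using mult[of A B] by (simp add: comm_D DT[of "commutator A B"])
  \<comment> \<open>In \<open>key\<close>, the two multiples of the commutator are traceless, which leaves \<open>n T = 0\<close>.\<close>
  have T_comm: "T (commutator A B) = 0" for A B
    using arg_cong[OF key[of A B], of trace] n
    by (simp add: trace_add trace_matrix_scale trace_commutator trace_mat)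
  obtain i j :: 'n where ij: "i \<noteq> j" using exists_index_avoiding_two[OF n] by metis
  have unit_comm: "commutator (matrix_unit i i) (matrix_unit i j) = matrix_unit i j"
    if "i \<noteq> j" for i j :: 'n
    using that by (simp add: commutator_def matrix_unit_mult_matrix_unit)
  have "matrix_scale c (commutator A B) = matrix_scale (c * c) (commutator A B)"
    for A B :: "complex^'n^'n"
    using key[of A B] by (simp add: T_comm mat_0)
  then have "matrix_scale c (matrix_unit i j) = matrix_scale (c * c) (matrix_unit i j)"
    using unit_comm[OF ij] by metis
  then have "matrix_scale c (matrix_unit i j) $ i $ j
      = matrix_scale (c * c) (matrix_unit i j) $ i $ j"
    by (simp only:)
  then have c: "c = 0 \<or> c = 1" by (simp add: matrix_scale_def matrix_unit_nth)
  \<comment> \<open>Evaluating \<open>T\<close> on \<open>E\<^sub>a\<^sub>b = [E\<^sub>a\<^sub>a, E\<^sub>a\<^sub>b]\<close> and on \<open>E\<^sub>a\<^sub>a - E\<^sub>i\<^sub>i = [E\<^sub>a\<^sub>i, E\<^sub>i\<^sub>a]\<close> determines it as a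
    multiple of the trace.\<close>
  have off: "\<tau> a b = 0" if "a \<noteq> b" for a b
    using T_comm[of "matrix_unit a a" "matrix_unit a b"] by (simp add: unit_comm[OF that] T_unit)
  define t where "t = \<tau> i i"
  have dia: "\<tau> a a = t" for a
  proof -
    have "T (matrix_unit a a - matrix_unit i i) = 0"
      using T_comm[of "matrix_unit a i" "matrix_unit i a"]
      by (simp add: commutator_def matrix_unit_mult_matrix_unit)
    moreover have "T (P - Q) = T P - T Q" for P Q
      by (simp add: T_def algebra_simps sum_subtractf)
    ultimately show ?thesis by (simp add: T_unit t_def)
  qed
  have "T A = t * trace A" for A
  proof -
    have "T A = (\<Sum>a\<in>UNIV. \<Sum>b\<in>UNIV. if b = a then A $ a $ b * t else 0)"
      unfolding T_def by (intro sum.cong) (auto simp: off dia)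
    then show ?thesis by (simp add: trace_def sum_distrib_left mult.commute)
  qed
  then have "D A = matrix_scale c A + mat (t * trace A)" for A
    by (simp only: DT)
  then show ?thesis by (rule that[OF c])
qed

section \<open>Bases and the matrix of the structure\<close>

lemma indexed_basis_sl_extend:
  fixes z :: "complex^'n^'n"
  assumes e: "gl.indexed_basis I e sl" and k: "k \<notin> I" and z: "trace z \<noteq> 0"
  shows "gl.indexed_basis (insert k I) (e(k := z)) UNIV"
proof -
  have inj: "inj_on e I" and ind: "gl.independent (e ` I)" and sp: "gl.span (e ` I) = sl"
    using e by (auto simp: gl.indexed_basis_def)
  have img: "(e(k := z)) ` insert k I = insert z (e ` I)"
    using k by auto
  have z_notin: "z \<notin> gl.span (e ` I)"
    using z by (simp add: sp sl_def)
  then have z_img: "z \<notin> e ` I" using gl.span_base by blast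
  have "inj_on (e(k := z)) (insert k I)"
    using inj k z_img by (auto simp: inj_on_def)
  moreover have "gl.independent (insert z (e ` I))"
    using z_notin ind by (simp add: gl.independent_insert)
  moreover have "A \<in> gl.span (insert z (e ` I))" for A
  proof -
    have "A - matrix_scale (trace A / trace z) z \<in> sl"
      using z by (simp add: sl_def trace_sub trace_matrix_scale)
    then show ?thesis unfolding gl.span_insert sp by blast
  qed
  ultimately show ?thesis unfolding gl.indexed_basis_def img by blast
qed

lemma matrix_wrt_eigenbasis:
  assumes b: "gl.indexed_basis I b UNIV" and i: "i \<in> I" and j: "j \<in> I"
    and eig: "D (b j) = matrix_scale (d j) (b j)"
  shows "gl.matrix_wrt I b D i j = diag d i j"
proof -
  have ind: "gl.independent (b ` I)" and inj: "inj_on b I"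
    using b by (auto simp: gl.indexed_basis_def)
  have "gl.representation (b ` I) (D (b j)) (b i)
      = d j * gl.representation (b ` I) (b j) (b i)"
    using j by (simp add: eig gl.representation_scale[OF ind] gl.span_base)
  also have "gl.representation (b ` I) (b j) (b i) = (if i = j then 1 else 0)"
    using gl.representation_basis[OF ind, of "b j"] i j inj by (auto dest: inj_onD)
  finally show ?thesis by (simp add: gl.matrix_wrt_def diag_def)
qed

theorem theorem3p3:
  fixes n :: nat
    and e :: "nat \<Rightarrow> complex^'n^'n"
    and z :: "complex^'n^'n"
    and D :: "complex^'n^'n \<Rightarrow> complex^'n^'n"
  assumes "n = CARD('n)" and "n \<ge> 3"
    and "gl.indexed_basis {1..n\<^sup>2 - 1} e sl"
    and "z \<in> range mat" and "z \<noteq> 0"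
    and "D \<in> gl.HLie\<^sub>m"
  shows "gl.indexed_basis {1..n\<^sup>2} (e(n\<^sup>2 := z)) UNIV \<and>
    (\<exists>a. (\<forall>i\<in>{1..n\<^sup>2}. \<forall>j\<in>{1..n\<^sup>2}.
            gl.matrix_wrt {1..n\<^sup>2} (e(n\<^sup>2 := z)) D i j = diag (\<lambda>k. if k < n\<^sup>2 then 1 else a) i j) \<or>
         (\<forall>i\<in>{1..n\<^sup>2}. \<forall>j\<in>{1..n\<^sup>2}.
            gl.matrix_wrt {1..n\<^sup>2} (e(n\<^sup>2 := z)) D i j = diag (\<lambda>k. if k < n\<^sup>2 then 0 else a) i j))"
proof -
  let ?b = "e(n\<^sup>2 := z)"
  have n3: "CARD('n) \<ge> 3" using assms(1,2) by simp
  have pos: "n\<^sup>2 > 0" using assms(2) by simp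
  then have idx: "{1..n\<^sup>2} = insert (n\<^sup>2) {1..n\<^sup>2 - 1}" and new: "n\<^sup>2 \<notin> {1..n\<^sup>2 - 1}"
    by (simp_all only: atLeastAtMost_iff set_eq_iff insert_iff) linarith+
  obtain s where s: "z = mat s" using assms(4) by auto
  then have "s \<noteq> 0" using assms(5) mat_0 by metis
  then have "trace z \<noteq> 0" by (simp add: s trace_mat)
  then have basis: "gl.indexed_basis {1..n\<^sup>2} ?b UNIV"
    unfolding idx using indexed_basis_sl_extend[OF assms(3) new] by blast
  obtain c t where c: "c = 0 \<or> c = 1" and D: "\<And>A. D A = matrix_scale c A + mat (t * trace A)"
    using multiplicative_hom_lie_shape[OF assms(6) n3] by blast
  define a where "a = c + t * of_nat n"
  have matrix: "gl.matrix_wrt {1..n\<^sup>2} ?b D i j = diag (\<lambda>k. if k < n\<^sup>2 then c else a) i j"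
    if i: "i \<in> {1..n\<^sup>2}" and j: "j \<in> {1..n\<^sup>2}" for i j
  proof (rule matrix_wrt_eigenbasis[OF basis i j])
    show "D (?b j) = matrix_scale (if j < n\<^sup>2 then c else a) (?b j)"
    proof (cases "j < n\<^sup>2")
      case True
      then have "e j \<in> gl.span (e ` {1..n\<^sup>2 - 1})" using j by (intro gl.span_base) auto
      then have "trace (e j) = 0" using assms(3) by (simp add: gl.indexed_basis_def sl_def)
      then show ?thesis using True by (simp add: D mat_def vec_eq_iff)
    next
      case False
      then have "j = n\<^sup>2" using j by simp
      then show ?thesis
        by (simp add: D s trace_mat a_def assms(1))
          (simp add: matrix_scale_def mat_def vec_eq_iff algebra_simps)
    qed
  qed
  from c show ?thesis
  proof
    assume "c = 0"
    then show ?thesis using basis matrix by blast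
  next
    assume "c = 1"
    then show ?thesis using basis matrix by blast
  qed
qed

end
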